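(* Let $f,-g,h_1,\ldots,h_m:\mathbb{R}^n\to\mathbb{R}$ be convex polynomials and let $K:=\{x\in\mathbb{R}^n\mid h_i(x)\le 0,\ i=1,\ldots,m\}$. Assume that $K$ is nonempty, that $f(x)\ge 0$ and $g(x)>0$ for every $x\in K$, and that $\sup_{x\in K} g(x)<+\infty$. Then the following statements hold. (i) The problem (FP) attains its optimal value at some $x^*\in K$. (ii) The problem (P$_{\rm CCT}$) attains its minimum at some $(s^*,t^* )$ with $t^*>0$ and $t^*g(s^*/t^* )-1=0$, and the optimal values of (FP) and (P$_{\rm CCT}$) coincide.
   Context: (FP) is the fractional program $\inf_{x\in K} \frac{f(x)}{g(x)}$. (P$_{\rm CCT}$) is its Charnes--Cooper reformulation, in the variables $(s,t)\in\mathbb{R}^n\times\mathbb{R}$: minimize $t\,f(s/t)$ subject to $t\,h_i(s/t)\le 0$ for $i=1,\ldots,m$, $\;1-t\,g(s/t)\le 0$, and $t>0$. *)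

theory Defs
  imports "HOL-Analysis.Analysis"
begin

definition convex_polynomial :: "(real ^ 'n \<Rightarrow> real) \<Rightarrow> bool" where
  "convex_polynomial p \<longleftrightarrow> real_polynomial_function p \<and> convex_on UNIV p"

definition feasible_set :: "nat \<Rightarrow> (nat \<Rightarrow> real ^ 'n \<Rightarrow> real) \<Rightarrow> (real ^ 'n) set" where
  "feasible_set m h = {x. \<forall>i\<in>{1..m}. h i x \<le> 0}"

(* The value is extended-real, so that it is the genuine infimum also for
   empty S (value \<infinity>) and for objectives that are unbounded below (value -\<infinity>). *)
definition optimal_value :: "'a set \<Rightarrow> ('a \<Rightarrow> real) \<Rightarrow> ereal" where
  "optimal_value S \<phi> = (INF x\<in>S. ereal (\<phi> x))"

definition attains_optimal_value_at :: "'a set \<Rightarrow> ('a \<Rightarrow> real) \<Rightarrow> 'a \<Rightarrow> bool" where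
  "attains_optimal_value_at S \<phi> x \<longleftrightarrow> x \<in> S \<and> ereal (\<phi> x) = optimal_value S \<phi>"

definition FP_objective :: "(real ^ 'n \<Rightarrow> real) \<Rightarrow> (real ^ 'n \<Rightarrow> real) \<Rightarrow> real ^ 'n \<Rightarrow> real" where
  "FP_objective f g x = f x / g x"

(* The vector s /\<^sub>R t is s scaled by the inverse of t. *)
definition CCT_objective :: "(real ^ 'n \<Rightarrow> real) \<Rightarrow> (real ^ 'n) \<times> real \<Rightarrow> real" where
  "CCT_objective f = (\<lambda>(s, t). t * f (s /\<^sub>R t))"

definition CCT_feasible_set ::
  "(real ^ 'n \<Rightarrow> real) \<Rightarrow> nat \<Rightarrow> (nat \<Rightarrow> real ^ 'n \<Rightarrow> real) \<Rightarrow> ((real ^ 'n) \<times> real) set" where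
  "CCT_feasible_set g m h =
     {(s, t). (\<forall>i\<in>{1..m}. t * h i (s /\<^sub>R t) \<le> 0) \<and> 1 - t * g (s /\<^sub>R t) \<le> 0 \<and> t > 0}"

end

theory Submission
  imports Defs
begin

text \<open>
  Both problems reduce to one fact about convex polynomials. Let \<open>l\<close> be the infimum of
  \<open>f / g\<close> over \<open>K\<close>; it is nonnegative, so \<open>f - l * g\<close> is a convex polynomial. Since \<open>g\<close> is
  bounded above on \<open>K\<close>, a near-minimizer of \<open>f / g\<close> makes \<open>f - l * g\<close> arbitrarily small, and a
  point of \<open>K\<close> with \<open>f - l * g \<le> 0\<close> is a minimizer of \<open>f / g\<close>. So it suffices that a finite
  system \<open>p i x \<le> 0\<close> of convex polynomial inequalities is solvable as soon as every relaxation
  \<open>p i x \<le> \<epsilon>\<close> is (\<open>convex_polynomial_system_solvable\<close>). This is a form of the Frank--Wolfe type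
  theorem of Belousov and Klatte; it fails for general convex functions such as \<open>exp\<close>.

  The system theorem is proved by induction on the number of inequalities. Suppose that the system
  has no solution, and let \<open>x k\<close> be the solution of least norm of a relaxation that tightens with
  \<open>k\<close>. Boundedness would make a limit point a solution, so the norms tend to infinity and, after
  passing to a subsequence, \<open>x k\<close> has a limiting direction \<open>d\<close>. Every \<open>p i\<close> is nonincreasing along
  \<open>d\<close>, and a convex polynomial in one variable that is bounded above on a ray is affine, so \<open>p i\<close>
  is affine along \<open>d\<close>, with a slope that by convexity does not depend on the base point. There are
  two cases. If some \<open>p j\<close> strictly decreases along \<open>d\<close>, solve the system without \<open>p j\<close> and move far
  along \<open>d\<close>, which preserves the other inequalities and achieves \<open>p j \<le> 0\<close>. Otherwise all \<open>p i\<close> are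
  invariant along \<open>d\<close>; then minimality of the norm forces \<open>x k\<close> to be orthogonal to \<open>d\<close>, which
  contradicts that \<open>d\<close> is its limiting direction.

  The Charnes--Cooper problem is handled by the substitution \<open>y = s / t\<close>. A feasible \<open>(s, t)\<close> gives
  \<open>y \<in> K\<close> with \<open>t \<ge> 1 / g y\<close>, and \<open>f y \<ge> 0\<close> turns this into \<open>t * f y \<ge> f y / g y\<close>; equality is
  reached with \<open>t = 1 / g x\<close> at a minimizer \<open>x\<close> of the fractional program.
\<close>

section \<open>Convex polynomials along recession directions\<close>

text \<open>
  After splitting off the constant term, \<open>q t = b 0 + t * r t\<close>, linear growth bounds the polynomial
  \<open>r\<close> on \<open>t \<ge> 1\<close>, and a nonconstant polynomial is unbounded there.
\<close>

lemma real_polynomial_linear_growth_affine: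
  fixes q :: "real \<Rightarrow> real"
  assumes "real_polynomial_function q"
    and growth: "\<And>t. t \<ge> 0 \<Longrightarrow> \<bar>q t\<bar> \<le> A + B * t"
  obtains c where "\<And>t. q t = q 0 + t * c"
proof -
  obtain a n where q: "q = (\<lambda>t. \<Sum>i\<le>n. a i * t ^ i)"
    using assms(1) real_polynomial_function_iff_sum by blast
  define b where "b i = (if i \<le> n then a i else 0)" for i
  define r where "r t = (\<Sum>i\<le>n. b (Suc i) * t ^ i)" for t :: real
  have q_r: "q t = b 0 + t * r t" for t
  proof -
    have "q t = (\<Sum>i\<le>Suc n. b i * t ^ i)"
      unfolding q by (simp add: b_def)
    also have "\<dots> = b 0 + (\<Sum>i\<le>n. b (Suc i) * t ^ Suc i)"
      by (subst sum.atMost_Suc_shift) simp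
    also have "(\<Sum>i\<le>n. b (Suc i) * t ^ Suc i) = t * r t"
      by (simp add: r_def sum_distrib_left mult_ac)
    finally show ?thesis .
  qed
  have r_bound: "\<bar>r t\<bar> \<le> \<bar>A\<bar> + \<bar>B\<bar> + \<bar>b 0\<bar>" if "t \<ge> 1" for t
  proof -
    have "t * \<bar>r t\<bar> = \<bar>q t - b 0\<bar>"
      using that by (simp add: q_r abs_mult)
    also have "\<dots> \<le> A + B * t + \<bar>b 0\<bar>"
      using growth[of t] that by linarith
    also have "\<dots> \<le> \<bar>A\<bar> * t + \<bar>B\<bar> * t + \<bar>b 0\<bar> * t"
    proof (intro add_mono)
      show "A \<le> \<bar>A\<bar> * t" "\<bar>b 0\<bar> \<le> \<bar>b 0\<bar> * t"
        using that mult_left_mono[of 1 t "\<bar>A\<bar>"] mult_left_mono[of 1 t "\<bar>b 0\<bar>"] by auto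
      show "B * t \<le> \<bar>B\<bar> * t"
        using that by (intro mult_right_mono) auto
    qed
    finally have "t * \<bar>r t\<bar> \<le> t * (\<bar>A\<bar> + \<bar>B\<bar> + \<bar>b 0\<bar>)"
      by (simp add: algebra_simps)
    then show ?thesis
      using that by (simp only: mult_le_cancel_left_pos)
  qed
  have r_const: "b (Suc i) = 0" if "i \<noteq> 0" "i \<le> n" for i
  proof (rule ccontr)
    assume "b (Suc i) \<noteq> 0"
    with that have "\<exists>k. k \<noteq> 0 \<and> k \<le> n \<and> b (Suc k) \<noteq> 0"
      by blast
    then have "\<forall>\<^sub>F t in at_infinity. norm (r t) \<ge> \<bar>A\<bar> + \<bar>B\<bar> + \<bar>b 0\<bar> + 1"
      unfolding r_def by (rule polyfun_extremal[where c = "\<lambda>i. b (Suc i)"])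
    then obtain T where T: "\<And>t. norm t \<ge> T \<Longrightarrow> norm (r t) \<ge> \<bar>A\<bar> + \<bar>B\<bar> + \<bar>b 0\<bar> + 1"
      by (auto simp: eventually_at_infinity)
    show False
      using T[of "max T 1"] r_bound[of "max T 1"] by auto
  qed
  have "r t = b (Suc 0)" for t
  proof -
    have "r t = (\<Sum>i\<in>{0}. b (Suc i) * t ^ i)"
      unfolding r_def by (rule sum.mono_neutral_right) (auto simp: r_const)
    then show ?thesis by simp
  qed
  then show thesis
    by (intro that[of "b (Suc 0)"]) (simp add: q_r)
qed

text \<open>
  An upper bound on a ray comes with a linear lower bound, by convexity. Hence the
  growth is linear, which leaves a polynomial no choice but to be affine, on the whole line.
\<close>

lemma convex_polynomial_bounded_above_affine:
  fixes q :: "real \<Rightarrow> real"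
  assumes poly: "real_polynomial_function q" and conv: "convex_on UNIV q"
    and bounded: "\<And>t. t \<ge> 0 \<Longrightarrow> q t \<le> q 0"
  obtains c where "\<And>t. q t = q 0 + t * c"
proof (rule real_polynomial_linear_growth_affine[OF poly])
  fix t :: real
  assume t: "t \<ge> 0"
  \<comment> \<open>Convexity at \<open>0\<close>, seen as a point between \<open>- 1\<close> and \<open>t\<close>, bounds \<open>q t\<close> from below.\<close>
  have "q ((1 - 1 / (1 + t)) *\<^sub>R (- 1) + (1 / (1 + t)) *\<^sub>R t)
      \<le> (1 - 1 / (1 + t)) * q (- 1) + 1 / (1 + t) * q t"
    using t by (intro convex_onD[OF conv]) auto
  moreover have "(1 - 1 / (1 + t)) *\<^sub>R (- 1) + (1 / (1 + t)) *\<^sub>R t = 0"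
    using t by (simp add: field_simps)
  ultimately have "(1 + t) * q 0 \<le> (1 + t) * ((1 - 1 / (1 + t)) * q (- 1) + 1 / (1 + t) * q t)"
    using t by (intro mult_left_mono) auto
  also have "\<dots> = ((1 + t) * (1 - 1 / (1 + t))) * q (- 1) + ((1 + t) * (1 / (1 + t))) * q t"
    by (simp only: distrib_left mult.assoc)
  also have "(1 + t) * (1 - 1 / (1 + t)) = t"
    using t by (simp add: right_diff_distrib)
  also have "(1 + t) * (1 / (1 + t)) = 1"
    using t by simp
  finally have "q t \<ge> q 0 - t * (q (- 1) - q 0)"
    by (simp add: algebra_simps)
  moreover have "t * (q (- 1) - q 0) \<le> t * \<bar>q (- 1) - q 0\<bar>"
    using t by (intro mult_left_mono) auto
  ultimately have "q t \<ge> q 0 - t * \<bar>q (- 1) - q 0\<bar>"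
    by linarith
  moreover have "0 \<le> t * \<bar>q (- 1) - q 0\<bar>"
    using t by simp
  ultimately show "\<bar>q t\<bar> \<le> \<bar>q 0\<bar> + \<bar>q (- 1) - q 0\<bar> * t"
    using bounded[OF t] abs_ge_self[of "q 0"] abs_ge_minus_self[of "q 0"]
    unfolding abs_le_iff mult.commute[of _ t] by linarith
qed (rule that)

lemma convex_polynomial_affine_along_recession_direction:
  fixes p :: "'a::euclidean_space \<Rightarrow> real"
  assumes poly: "real_polynomial_function p" and conv: "convex_on UNIV p"
    and recession: "\<And>y t. t \<ge> 0 \<Longrightarrow> p (y + t *\<^sub>R d) \<le> p y"
  shows "p (y + t *\<^sub>R d) = p y + t * (p (y + d) - p y)"
proof -
  define q where "q t = p (y + t *\<^sub>R d)" for t :: real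
  have "polynomial_function (\<lambda>t. y + t *\<^sub>R d)"
    by (intro polynomial_function_add polynomial_function_const polynomial_function_mult
        polynomial_function_id)
  then have "real_polynomial_function (p \<circ> (\<lambda>t. y + t *\<^sub>R d))"
    using poly by (rule real_polynomial_function_compose)
  then have "real_polynomial_function q"
    by (simp add: q_def[abs_def] o_def)
  moreover have "convex_on UNIV q"
  proof (rule convex_onI)
    fix l a b :: real
    assume "0 < l" "l < 1"
    then have "p ((1 - l) *\<^sub>R (y + a *\<^sub>R d) + l *\<^sub>R (y + b *\<^sub>R d)) \<le> (1 - l) * q a + l * q b"
      unfolding q_def by (intro convex_onD[OF conv]) auto
    then show "q ((1 - l) *\<^sub>R a + l *\<^sub>R b) \<le> (1 - l) * q a + l * q b"
      by (simp add: q_def algebra_simps)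
  qed auto
  moreover have "q t \<le> q 0" if "t \<ge> 0" for t
    using recession[OF that] by (simp add: q_def)
  ultimately obtain c where c: "\<And>t. q t = q 0 + t * c"
    using convex_polynomial_bounded_above_affine by blast
  have "q t = q 0 + t * (q 1 - q 0)"
    using c[of t] c[of 1] by simp
  then show ?thesis
    by (simp add: q_def)
qed

text \<open>
  Compare \<open>z + t *\<^sub>R d\<close> with points of the segments from \<open>z\<close> to far points \<open>y + (t / l) *\<^sub>R d\<close> of the
  given ray: as \<open>l\<close> tends to \<open>0\<close>, the point with weight \<open>l\<close> on the far end tends to \<open>z + t *\<^sub>R d\<close>, while the
  convexity bound tends to \<open>p z + t * c\<close>.
\<close>

lemma convex_recession_slope_base_point_independent:
  fixes p :: "'a::euclidean_space \<Rightarrow> real"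
  assumes conv: "convex_on UNIV p"
    and ray: "\<And>t. t \<ge> 0 \<Longrightarrow> p (y + t *\<^sub>R d) \<le> p y + t * c"
    and t: "t \<ge> 0"
  shows "p (z + t *\<^sub>R d) \<le> p z + t * c"
proof -
  have cont: "continuous_on UNIV p"
    using conv by (intro convex_on_continuous) auto
  define l where "l k = inverse (real (Suc k))" for k
  have l: "l \<longlonglongrightarrow> 0" "l k > 0" "l k \<le> 1" for k
    unfolding l_def using LIMSEQ_inverse_real_of_nat by (auto simp: field_simps)
  have "p ((1 - l k) *\<^sub>R z + l k *\<^sub>R y + t *\<^sub>R d) \<le> (1 - l k) * p z + l k * p y + t * c" for k
  proof -
    have "p ((1 - l k) *\<^sub>R z + l k *\<^sub>R (y + (t / l k) *\<^sub>R d))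
        \<le> (1 - l k) * p z + l k * p (y + (t / l k) *\<^sub>R d)"
      using l(2,3)[of k] by (intro convex_onD[OF conv]) auto
    also have "\<dots> \<le> (1 - l k) * p z + l k * (p y + t / l k * c)"
      using l(2,3)[of k] t by (intro add_left_mono mult_left_mono ray) auto
    finally show ?thesis
      using l(2)[of k] by (simp add: algebra_simps)
  qed
  moreover have "(\<lambda>k. p ((1 - l k) *\<^sub>R z + l k *\<^sub>R y + t *\<^sub>R d)) \<longlonglongrightarrow> p ((1 - 0) *\<^sub>R z + 0 *\<^sub>R y + t *\<^sub>R d)"
    by (rule continuous_on_tendsto_compose[OF cont]) (intro tendsto_intros l, auto)
  moreover have "(\<lambda>k. (1 - l k) * p z + l k * p y + t * c) \<longlonglongrightarrow> (1 - 0) * p z + 0 * p y + t * c"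
    by (intro tendsto_intros l)
  ultimately have "p ((1 - 0) *\<^sub>R z + 0 *\<^sub>R y + t *\<^sub>R d) \<le> (1 - 0) * p z + 0 * p y + t * c"
    by (intro LIMSEQ_le) blast+
  then show ?thesis by simp
qed

text \<open>
  The segments from \<open>y\<close> to \<open>x k\<close> converge to the ray from \<open>y\<close> in direction \<open>d\<close>. On a segment, the
  point at bounded distance from \<open>y\<close> gives a vanishing weight \<open>t / norm (x k)\<close> to the endpoint
  \<open>x k\<close>, whose value is at most \<open>C\<close>.
\<close>

lemma asymptotic_direction_is_recession_direction:
  fixes p :: "'a::euclidean_space \<Rightarrow> real"
  assumes conv: "convex_on UNIV p"
    and bounded: "\<And>k. p (x k) \<le> C"
    and norm: "filterlim (\<lambda>k. norm (x k)) at_top sequentially"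
    and d: "(\<lambda>k. x k /\<^sub>R norm (x k)) \<longlonglongrightarrow> d"
    and t: "t \<ge> 0"
  shows "p (y + t *\<^sub>R d) \<le> p y"
proof -
  have cont: "continuous_on UNIV p"
    using conv by (intro convex_on_continuous) auto
  define l where "l k = t * inverse (norm (x k))" for k
  have l: "l \<longlonglongrightarrow> 0"
    unfolding l_def using tendsto_mult_right_zero[OF tendsto_inverse_0_at_top[OF norm]] .
  have "\<forall>\<^sub>F k in sequentially. l k < 1"
    using l by (rule order_tendstoD) simp
  then have "\<forall>\<^sub>F k in sequentially.
      p ((1 - l k) *\<^sub>R y + t *\<^sub>R (x k /\<^sub>R norm (x k))) \<le> (1 - l k) * p y + l k * C"
  proof eventually_elim
    case (elim k)
    have "0 \<le> l k"
      unfolding l_def using t by simp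
    have "p ((1 - l k) *\<^sub>R y + l k *\<^sub>R x k) \<le> (1 - l k) * p y + l k * p (x k)"
      using elim \<open>0 \<le> l k\<close> by (intro convex_onD[OF conv]) auto
    also have "\<dots> \<le> (1 - l k) * p y + l k * C"
      using \<open>0 \<le> l k\<close> by (intro add_left_mono mult_left_mono bounded)
    finally show ?case by (simp add: l_def)
  qed
  moreover have "(\<lambda>k. p ((1 - l k) *\<^sub>R y + t *\<^sub>R (x k /\<^sub>R norm (x k)))) \<longlonglongrightarrow> p ((1 - 0) *\<^sub>R y + t *\<^sub>R d)"
    by (rule continuous_on_tendsto_compose[OF cont]) (intro tendsto_intros l d, auto)
  moreover have "(\<lambda>k. (1 - l k) * p y + l k * C) \<longlonglongrightarrow> (1 - 0) * p y + 0 * C"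
    by (intro tendsto_intros l)
  ultimately have "p ((1 - 0) *\<^sub>R y + t *\<^sub>R d) \<le> (1 - 0) * p y + 0 * C"
    by (intro tendsto_le[OF sequentially_bot]) 
  then show ?thesis by simp
qed

section \<open>Solvability of convex polynomial systems\<close>

text \<open>
  The obstruction to solving a system whose relaxations are solvable can only lie at infinity. The
  points \<open>x k\<close> are taken of least norm because this is what rules out, later on, directions along
  which all \<open>p i\<close> are constant.
\<close>

lemma approximate_solutions_limit_or_direction:
  fixes p :: "'i \<Rightarrow> 'a::euclidean_space \<Rightarrow> real"
  assumes cont: "\<And>i. i \<in> I \<Longrightarrow> continuous_on UNIV (p i)"
    and approx: "\<And>\<epsilon>. \<epsilon> > 0 \<Longrightarrow> \<exists>x. \<forall>i\<in>I. p i x \<le> \<epsilon>"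
    and unsolvable: "\<nexists>x. \<forall>i\<in>I. p i x \<le> 0"
  obtains x :: "nat \<Rightarrow> 'a" and \<epsilon> :: "nat \<Rightarrow> real" and d where
    "\<And>k. 0 < \<epsilon> k" "\<And>k. \<epsilon> k \<le> 1"
    "\<And>k i. i \<in> I \<Longrightarrow> p i (x k) \<le> \<epsilon> k"
    "\<And>k y. (\<And>i. i \<in> I \<Longrightarrow> p i y \<le> \<epsilon> k) \<Longrightarrow> norm (x k) \<le> norm y"
    "filterlim (\<lambda>k. norm (x k)) at_top sequentially"
    "(\<lambda>k. x k /\<^sub>R norm (x k)) \<longlonglongrightarrow> d" "norm d = 1"
proof -
  define e where "e k = inverse (real (Suc k))" for k
  define S where "S k = {y. \<forall>i\<in>I. p i y \<le> e k}" for k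
  have e: "0 < e k" "e k \<le> 1" "e \<longlonglongrightarrow> 0" for k
    unfolding e_def using LIMSEQ_inverse_real_of_nat by (auto simp: field_simps)
  have "closed (S k)" for k
  proof -
    have "S k = (\<Inter>i\<in>I. {y. p i y \<le> e k})"
      by (auto simp: S_def)
    then show ?thesis
      by (auto intro!: closed_Collect_le cont continuous_on_const)
  qed
  moreover have "S k \<noteq> {}" for k
    using approx[OF e(1)] by (auto simp: S_def)
  ultimately have "\<exists>y\<in>S k. \<forall>z\<in>S k. dist 0 y \<le> dist 0 z" for k
    using distance_attains_inf[of "S k" 0] by metis
  then obtain u where u: "\<And>k. u k \<in> S k" and u_min: "\<And>k z. z \<in> S k \<Longrightarrow> norm (u k) \<le> norm z"
    by (simp add: dist_norm) metis
  have norm_mono: "norm (u j) \<le> norm (u k)" if "j \<le> k" for j k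
  proof (rule u_min)
    have "e k \<le> e j"
      using that by (simp add: e_def)
    then show "u k \<in> S j"
      using u[of k] by (auto simp: S_def intro: order_trans)
  qed
  have unbounded: "\<not> bounded (range u)"
  proof
    assume "bounded (range u)"
    then obtain l r where r: "strict_mono r" and l: "(u \<circ> r) \<longlonglongrightarrow> l"
      using bounded_imp_convergent_subsequence by blast
    have "p i l \<le> 0" if "i \<in> I" for i
    proof (rule LIMSEQ_le)
      show "(\<lambda>k. p i ((u \<circ> r) k)) \<longlonglongrightarrow> p i l"
        by (rule continuous_on_tendsto_compose[OF cont[OF that] l]) auto
      show "(e \<circ> r) \<longlonglongrightarrow> 0"
        using e(3) r by (rule LIMSEQ_subseq_LIMSEQ)
      show "\<exists>N. \<forall>k\<ge>N. p i ((u \<circ> r) k) \<le> (e \<circ> r) k"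
        using u that by (auto simp: S_def)
    qed
    with unsolvable show False by blast
  qed
  have norm_u: "filterlim (\<lambda>k. norm (u k)) at_top sequentially"
    unfolding filterlim_at_top eventually_sequentially
  proof
    fix B :: real
    obtain j where "norm (u j) > B"
      using unbounded by (auto simp: bounded_iff not_le)
    then show "\<exists>N. \<forall>k\<ge>N. B \<le> norm (u k)"
      using norm_mono by (intro exI[of _ j]) (meson less_imp_le order_trans)
  qed
  have "bounded (range (\<lambda>k. u k /\<^sub>R norm (u k)))"
    by (rule boundedI[of _ 1]) (auto simp: divide_simps)
  then obtain d r where r: "strict_mono r" and d: "((\<lambda>k. u k /\<^sub>R norm (u k)) \<circ> r) \<longlonglongrightarrow> d"
    using bounded_imp_convergent_subsequence by blast
  have norm_ur: "filterlim (\<lambda>k. norm (u (r k))) at_top sequentially"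
    using filterlim_compose[OF norm_u filterlim_subseq[OF r]] .
  have "norm d = 1"
  proof (rule LIMSEQ_unique)
    show "(\<lambda>k. norm (u (r k) /\<^sub>R norm (u (r k)))) \<longlonglongrightarrow> norm d"
      using tendsto_norm[OF d] by (simp add: o_def)
    have "\<forall>\<^sub>F k in sequentially. norm (u (r k)) \<ge> 1"
      using norm_ur by (simp add: filterlim_at_top)
    then show "(\<lambda>k. norm (u (r k) /\<^sub>R norm (u (r k)))) \<longlonglongrightarrow> 1"
      by (intro tendsto_eventually) (auto elim!: eventually_mono intro!: left_inverse)
  qed
  show thesis
  proof (rule that[of "e \<circ> r" "u \<circ> r" d])
    show "p i ((u \<circ> r) k) \<le> (e \<circ> r) k" if "i \<in> I" for k i
      using u[of "r k"] that by (simp add: S_def)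
    show "norm ((u \<circ> r) k) \<le> norm y" if "\<And>i. i \<in> I \<Longrightarrow> p i y \<le> (e \<circ> r) k" for k y
      using u_min[of y "r k"] that by (simp add: S_def)
  qed (use e d norm_ur \<open>norm d = 1\<close> in \<open>auto simp: o_def\<close>)
qed

text \<open>
  Applied to the polynomials \<open>\<lambda>x. p i x - b i\<close>, this says that the right-hand sides \<open>b\<close> for which
  \<open>p i x \<le> b i\<close> is solvable form a closed set. The induction removes an inequality that decreases along the limiting direction of the
  minimal-norm approximate solutions.
\<close>

theorem convex_polynomial_system_solvable:
  fixes p :: "'i \<Rightarrow> 'a::euclidean_space \<Rightarrow> real"
  assumes "finite I"
    and "\<And>i. i \<in> I \<Longrightarrow> real_polynomial_function (p i)"
    and "\<And>i. i \<in> I \<Longrightarrow> convex_on UNIV (p i)"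
    and "\<And>\<epsilon>. \<epsilon> > 0 \<Longrightarrow> \<exists>x. \<forall>i\<in>I. p i x \<le> \<epsilon>"
  shows "\<exists>x. \<forall>i\<in>I. p i x \<le> 0"
  using assms
proof (induction I rule: finite_psubset_induct)
  case (psubset I)
  note poly = psubset.prems(1) and conv = psubset.prems(2) and approx = psubset.prems(3)
  have cont: "continuous_on UNIV (p i)" if "i \<in> I" for i
    using conv[OF that] by (intro convex_on_continuous) auto
  show ?case
  proof (rule ccontr)
    assume unsolvable: "\<nexists>x. \<forall>i\<in>I. p i x \<le> 0"
    obtain x :: "nat \<Rightarrow> 'a" and e :: "nat \<Rightarrow> real" and d where
      e: "\<And>k. 0 < e k" "\<And>k. e k \<le> 1" and
      x: "\<And>k i. i \<in> I \<Longrightarrow> p i (x k) \<le> e k" and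
      x_min: "\<And>k y. (\<And>i. i \<in> I \<Longrightarrow> p i y \<le> e k) \<Longrightarrow> norm (x k) \<le> norm y" and
      norm_x: "filterlim (\<lambda>k. norm (x k)) at_top sequentially" and
      d: "(\<lambda>k. x k /\<^sub>R norm (x k)) \<longlonglongrightarrow> d" "norm d = 1"
      by (rule approximate_solutions_limit_or_direction[OF cont approx unsolvable]) blast+
    have recession: "p i (y + t *\<^sub>R d) \<le> p i y" if "i \<in> I" "t \<ge> 0" for i y t
      using conv[OF that(1)] order_trans[OF x[OF that(1)] e(2)] norm_x d(1) that(2)
      by (rule asymptotic_direction_is_recession_direction)
    have affine: "p i (y + t *\<^sub>R d) = p i y + t * (p i (y + d) - p i y)" if "i \<in> I" for i y t
      using poly[OF that] conv[OF that] recession[OF that]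
      by (rule convex_polynomial_affine_along_recession_direction)
    show False
    proof (cases "\<exists>j\<in>I. \<exists>y. p j (y + d) < p j y")
      case True
      then obtain j y where j: "j \<in> I" and y: "p j (y + d) < p j y"
        by blast
      define c where "c = p j (y + d) - p j y"
      have "\<exists>z. \<forall>i\<in>I - {j}. p i z \<le> 0"
      proof (rule psubset.IH)
        show "\<exists>z. \<forall>i\<in>I - {j}. p i z \<le> \<epsilon>" if "\<epsilon> > 0" for \<epsilon>
          using approx[OF that] by blast
      qed (use j poly conv in auto)
      then obtain z where z: "\<And>i. i \<in> I - {j} \<Longrightarrow> p i z \<le> 0"
        by blast
      \<comment> \<open>The step length for which a decrease at slope \<open>c\<close> outweighs the value at \<open>z\<close>.\<close>
      define t where "t = \<bar>p j z\<bar> / - c"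
      have "c < 0"
        using y by (simp add: c_def)
      then have t: "t \<ge> 0" "t * c = - \<bar>p j z\<bar>"
        by (auto simp: t_def divide_nonneg_neg)
      have "p j (z + t *\<^sub>R d) \<le> p j z + t * c"
        using conv[OF j] _ t(1)
        by (rule convex_recession_slope_base_point_independent[where y = y])
           (subst affine[OF j], simp add: c_def)
      then have "p j (z + t *\<^sub>R d) \<le> 0"
        using t by simp
      moreover have "p i (z + t *\<^sub>R d) \<le> 0" if "i \<in> I - {j}" for i
        using order_trans[OF recession z] that t(1) by blast
      ultimately show False
        using unsolvable by blast
    next
      case False
      have invariant: "p i (y + t *\<^sub>R d) = p i y" if "i \<in> I" for i y t
      proof -
        have "p i (y + d) = p i y"
          using recession[OF that, of 1 y] False that by (auto intro: antisym simp: not_less)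
        then show ?thesis
          using affine[OF that, of y t] by simp
      qed
      have orthogonal: "x k \<bullet> d = 0" for k
      proof -
        \<comment> \<open>The projection of \<open>x k\<close> to the complement of \<open>d\<close> is still an approximate solution.\<close>
        define y where "y = x k + (- (x k \<bullet> d)) *\<^sub>R d"
        have "norm (x k) \<le> norm y"
          by (rule x_min) (simp only: y_def invariant x)
        then have "x k \<bullet> x k \<le> y \<bullet> y"
          by (simp add: norm_le)
        also have "\<dots> = x k \<bullet> x k - (x k \<bullet> d)\<^sup>2"
          using d(2)
          by (simp add: y_def inner_diff_left inner_diff_right inner_commute[of d "x k"] power2_eq_square
              norm_eq_1)
        finally show ?thesis by simp
      qed
      have "(\<lambda>k. (x k /\<^sub>R norm (x k)) \<bullet> d) \<longlonglongrightarrow> d \<bullet> d"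
        by (intro tendsto_intros d)
      then have "d \<bullet> d = 0"
        using LIMSEQ_const_iff[of 0 "d \<bullet> d"] by (simp add: orthogonal)
      then show False
        using d(2) by simp
    qed
  qed
qed

section \<open>The fractional program and its Charnes--Cooper reformulation\<close>

text \<open>
  The objective enters the polynomial system as the additional inequality \<open>f x - l * g x \<le> 0\<close>, under
  the free index \<open>0\<close>. The bound \<open>M\<close> converts an error \<open>\<epsilon> / M\<close> in the ratio into an error \<open>\<epsilon>\<close> in this
  inequality; \<open>f \<ge> 0\<close> on \<open>K\<close> makes \<open>l\<close> nonnegative, hence \<open>f - l * g\<close> convex.
\<close>

lemma FP_attained:
  fixes f g :: "real ^ 'n \<Rightarrow> real"
  assumes f: "convex_polynomial f" and g: "convex_polynomial (\<lambda>x. - g x)"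
    and h: "\<And>i. i \<in> {1..m} \<Longrightarrow> convex_polynomial (h i)"
    and K: "K = feasible_set m h" "K \<noteq> {}"
    and f_nonneg: "\<And>x. x \<in> K \<Longrightarrow> f x \<ge> 0"
    and g_pos: "\<And>x. x \<in> K \<Longrightarrow> g x > 0"
    and g_bounded: "\<And>x. x \<in> K \<Longrightarrow> g x \<le> M"
  obtains x where "x \<in> K" "\<And>y. y \<in> K \<Longrightarrow> f x / g x \<le> f y / g y"
proof -
  define l where "l = (INF x\<in>K. f x / g x)"
  have ratio_nonneg: "f x / g x \<ge> 0" if "x \<in> K" for x
    using f_nonneg[OF that] g_pos[OF that] by simp
  then have bdd: "bdd_below ((\<lambda>x. f x / g x) ` K)"
    by (intro bdd_belowI2)
  have l_le: "l \<le> f y / g y" if "y \<in> K" for y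
    unfolding l_def using bdd that by (rule cINF_lower)
  have l_nonneg: "l \<ge> 0"
    unfolding l_def using K(2) ratio_nonneg by (rule cINF_greatest)
  have M: "M > 0"
    using K(2) g_pos g_bounded by (meson all_not_in_conv less_le_trans)
  define p where "p i = (if i = 0 then (\<lambda>x. f x - l * g x) else h i)" for i
  have conv_poly_p0: "convex_polynomial (\<lambda>x. f x - l * g x)"
  proof -
    have "real_polynomial_function (\<lambda>x. f x + l * - g x)"
      using f g unfolding convex_polynomial_def
      by (intro real_polynomial_function.intros(3,4) real_polynomial_function.intros(2)) auto
    moreover have "convex_on UNIV (\<lambda>x. f x + l * - g x)"
      using f g l_nonneg unfolding convex_polynomial_def by (intro convex_on_add convex_on_cmul) auto
    ultimately show ?thesis
      by (simp add: convex_polynomial_def)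
  qed
  have conv_poly_p: "convex_polynomial (p i)" if "i \<in> {0..m}" for i
    using conv_poly_p0 h that by (auto simp: p_def)
  have "\<exists>x. \<forall>i\<in>{0..m}. p i x \<le> 0"
  proof (rule convex_polynomial_system_solvable)
    show "\<exists>x. \<forall>i\<in>{0..m}. p i x \<le> \<epsilon>" if "\<epsilon> > 0" for \<epsilon>
    proof -
      have "l < l + \<epsilon> / M"
        using that M by simp
      then obtain x where x: "x \<in> K" and lt: "f x / g x < l + \<epsilon> / M"
        unfolding l_def using cINF_less_iff[OF K(2) bdd] by blast
      have "f x < (l + \<epsilon> / M) * g x"
        using lt g_pos[OF x] by (simp add: pos_divide_less_eq)
      also have "\<dots> = l * g x + \<epsilon> * (g x / M)"
        by (simp add: algebra_simps)
      also have "\<dots> \<le> l * g x + \<epsilon> * 1"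
        using g_bounded[OF x] that M by (intro add_left_mono mult_left_mono) auto
      finally have "p 0 x \<le> \<epsilon>"
        by (simp add: p_def)
      moreover have "p i x \<le> \<epsilon>" if "i \<in> {1..m}" for i
        using x that \<open>\<epsilon> > 0\<close> by (force simp: K p_def feasible_set_def)
      ultimately show ?thesis
        by (intro exI[of _ x] ballI) (metis One_nat_def Suc_leI atLeastAtMost_iff neq0_conv)
    qed
  qed (use conv_poly_p in \<open>auto simp: convex_polynomial_def\<close>)
  then obtain x where x: "\<And>i. i \<in> {0..m} \<Longrightarrow> p i x \<le> 0"
    by blast
  have "h i x \<le> 0" if "i \<in> {1..m}" for i
    using x[of i] that by (simp add: p_def)
  then have "x \<in> K"
    by (simp add: K feasible_set_def)
  moreover have "f x / g x \<le> l"
    using x[of 0] g_pos[OF \<open>x \<in> K\<close>] by (simp add: p_def pos_divide_le_eq)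
  ultimately show thesis
    using that order_trans[OF _ l_le] by simp
qed

lemma attains_optimal_value_atI:
  assumes "x \<in> S" "\<And>y. y \<in> S \<Longrightarrow> \<phi> x \<le> \<phi> y"
  shows "attains_optimal_value_at S \<phi> x"
proof -
  have "(INF y\<in>S. ereal (\<phi> y)) \<le> ereal (\<phi> x)"
    using assms(1) by (rule INF_lower)
  moreover have "ereal (\<phi> x) \<le> (INF y\<in>S. ereal (\<phi> y))"
    using assms(2) by (intro INF_greatest) simp
  ultimately show ?thesis
    using assms(1) by (simp add: attains_optimal_value_at_def optimal_value_def antisym)
qed

theorem theorem4p1:
  fixes f g :: "real ^ 'n \<Rightarrow> real"
    and m :: nat
    and h :: "nat \<Rightarrow> real ^ 'n \<Rightarrow> real"
    and K :: "(real ^ 'n) set"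
  assumes "convex_polynomial f"
    and "convex_polynomial (\<lambda>x. - g x)"
    and "\<And>i. i \<in> {1..m} \<Longrightarrow> convex_polynomial (h i)"
    and "K = feasible_set m h"
    and "K \<noteq> {}"
    and "\<And>x. x \<in> K \<Longrightarrow> f x \<ge> 0"
    and "\<And>x. x \<in> K \<Longrightarrow> g x > 0"
    and "(SUP x\<in>K. ereal (g x)) < \<infinity>"
  shows "(\<exists>x\<in>K. attains_optimal_value_at K (FP_objective f g) x) \<and>
    (\<exists>s t. attains_optimal_value_at (CCT_feasible_set g m h) (CCT_objective f) (s, t) \<and>
           t > 0 \<and> t * g (s /\<^sub>R t) - 1 = 0) \<and>
    optimal_value K (FP_objective f g) =
      optimal_value (CCT_feasible_set g m h) (CCT_objective f)"
proof -
  obtain M :: real where "(SUP x\<in>K. ereal (g x)) < ereal M"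
    using assms(8) less_PInf_Ex_of_nat by auto
  then have "g x \<le> M" if "x \<in> K" for x
    using SUP_upper[OF that, of "\<lambda>x. ereal (g x)"] by (meson ereal_less_eq(3) le_less_trans less_imp_le)
  with assms(1-7) obtain x where x: "x \<in> K" and x_min: "\<And>y. y \<in> K \<Longrightarrow> f x / g x \<le> f y / g y"
    using FP_attained by metis
  define t where "t = 1 / g x"
  define s where "s = t *\<^sub>R x"
  have t: "t > 0" "t * g x = 1"
    using assms(7)[OF x] by (auto simp: t_def)
  have s: "s /\<^sub>R t = x"
    using t by (simp add: s_def)
  have FP: "attains_optimal_value_at K (FP_objective f g) x"
    using x x_min by (intro attains_optimal_value_atI) (auto simp: FP_objective_def)
  have CCT_value: "CCT_objective f (s, t) = FP_objective f g x"
    by (simp add: CCT_objective_def FP_objective_def s) (simp add: t_def)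
  have CCT: "attains_optimal_value_at (CCT_feasible_set g m h) (CCT_objective f) (s, t)"
  proof (rule attains_optimal_value_atI)
    show "(s, t) \<in> CCT_feasible_set g m h"
      using x t by (auto simp: CCT_feasible_set_def s assms(4) feasible_set_def mult_nonneg_nonpos)
  next
    fix z
    assume z: "z \<in> CCT_feasible_set g m h"
    obtain s' t' where z_eq: "z = (s', t')"
      by fastforce
    define y where "y = s' /\<^sub>R t'"
    have t': "t' > 0" and ty: "t' * g y \<ge> 1"
      using z by (auto simp: z_eq CCT_feasible_set_def y_def)
    have y: "y \<in> K"
      using z t' by (auto simp: z_eq CCT_feasible_set_def y_def assms(4) feasible_set_def
          mult_le_0_iff)
    have "f x / g x \<le> f y / g y"
      using y by (rule x_min)
    also have "\<dots> = f y * (1 / g y)"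
      by simp
    also have "\<dots> \<le> f y * t'"
      using assms(6,7)[OF y] ty by (intro mult_left_mono) (auto simp: pos_divide_le_eq)
    also have "\<dots> = CCT_objective f z"
      by (simp add: CCT_objective_def z_eq y_def)
    finally show "CCT_objective f (s, t) \<le> CCT_objective f z"
      by (simp add: CCT_value FP_objective_def)
  qed
  have "optimal_value K (FP_objective f g) =
      optimal_value (CCT_feasible_set g m h) (CCT_objective f)"
    using FP CCT CCT_value by (simp add: attains_optimal_value_at_def)
  moreover have "t * g (s /\<^sub>R t) - 1 = 0"
    using t s by simp
  ultimately show ?thesis
    using FP CCT x t by blast
qed

end
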